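(* If $\{\mathcal{I}_j\}$ generates a SK, then $\mathsf{S}_{\mathrm{L}}(\{\mathcal{I}_j\})=\mathsf{M}^\star(\{\mathcal{J}^\star_j\})=\left|\bigcup_j\mathcal{J}^\star_j\right|-1$, where $\{\mathcal{J}^\star_j\}$ is any minimum $1$-critical subfamily of $\{\mathcal{I}_j\}$.
   Context: Network model: $n$ clients $c_1,\dots,c_n$, finite sets $\mathcal{I}_1,\dots,\mathcal{I}_n$ of message indices (the family $\{\mathcal{I}_j\}$); messages $X_i$ ($i\in\bigcup_j\mathcal{I}_j$) i.i.d. uniform on a finite field $\mathbb{F}$ with $|\mathbb{F}|>n$; client $c_j$ holds $\{X_i:i\in\mathcal{I}_j\}$; $\underline{X}$ is the vector of all messages. A protocol: in each of $t$ rounds one client broadcasts to all an element of $\mathbb{F}$ that is a function of its own messages, the round index, and all previous broadcasts; $\mathbf{T}(\underline{X})\in\mathbb{F}^t$ collects the broadcasts. Linear protocol: each broadcast is an $\mathbb{F}$-linear combination of the transmitter's messages. A protocol generates a SK if there are functions $\mathsf{k}_j$ with $K=\mathsf{k}_1(\{X_i:i\in\mathcal{I}_1\},\mathbf{T}(\underline{X}))$ such that (i) $\mathsf{k}_j(\{X_i:i\in\mathcal{I}_j\},\mathbf{T}(\underline{X}))=K$ a.s. for all $j$; (ii) $K$ is uniform on $\mathbb{F}$; (iii) $I(K;\mathbf{T}(\underline{X}))=0$. "$\{\mathcal{I}_j\}$ generates a SK" means some protocol generates a SK. $\mathsf{S}_{\mathrm{L}}$ is the minimum number of transmissions of a linear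 protocol generating a SK. $\mathsf{M}^\star(\{\mathcal{I}_j\})$ is the optimal value of: minimize $\sum_{j\in[n]}a_j$ over $a\in\mathbb{Z}^n$ subject to $\sum_{j\in\mathcal{S}}a_j\ge\left|\bigcap_{j\in[n]\setminus\mathcal{S}}\bar{\mathcal{I}}_j\right|$ for every nonempty proper $\mathcal{S}\subsetneq[n]$, where $\bar{\mathcal{I}}_j=(\bigcup_i\mathcal{I}_i)\setminus\mathcal{I}_j$. Subfamily: $\{\mathcal{J}_j\}$ with $\mathcal{J}_j=\mathcal{I}_j\setminus\mathcal{R}$ for all $j$, for some $\mathcal{R}\subseteq\bigcup_j\mathcal{I}_j$. For an integer $\tau\ge1$, a family $\{\mathcal{J}_j\}$ is $\tau$-critical if (i) $|\bigcup_j\mathcal{J}_j|-\mathsf{M}^\star(\{\mathcal{J}_j\})=\tau$ and (ii) $\mathsf{M}^\star(\{\mathcal{J}_j\setminus\{i\}\})=\mathsf{M}^\star(\{\mathcal{J}_j\})$ for all $i\in\bigcup_j\mathcal{J}_j$. A minimum $\tau$-critical subfamily of $\{\mathcal{I}_j\}$ is a $\tau$-critical subfamily $\{\mathcal{J}^\star_j\}$ with $|\bigcup_j\mathcal{J}^\star_j|\le|\bigcup_j\mathcal{J}_j|$ for every $\tau$-critical subfamily $\{\mathcal{J}_j\}$ of $\{\mathcal{I}_j\}$. *)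

theory Defs
  imports Main "HOL-Library.FuncSet"
begin

text \<open>Clients are indexed by 0..n-1; I j is the set of message indices held by client j.
Messages are indexed by natural numbers and take values in a finite field 'f.\<close>

definition msgs :: "nat \<Rightarrow> (nat \<Rightarrow> nat set) \<Rightarrow> nat set" where
  "msgs n I = (\<Union>j<n. I j)"

text \<open>Sample space of the message vector X (uniform distribution = counting measure).\<close>
definition space :: "nat \<Rightarrow> (nat \<Rightarrow> nat set) \<Rightarrow> (nat \<Rightarrow> 'f) set" where
  "space n I = PiE (msgs n I) (\<lambda>_. UNIV)"

definition transcript :: "nat \<Rightarrow> (nat \<Rightarrow> (nat \<Rightarrow> 'f) \<Rightarrow> 'f) \<Rightarrow> (nat \<Rightarrow> 'f) \<Rightarrow> 'f list" where
  "transcript t g x = map (\<lambda>r. g r x) [0..<t]"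

text \<open>A protocol with t rounds: in round r client s r broadcasts g r X, which is a function
of its own messages and the previous broadcasts.\<close>
definition valid_protocol ::
  "nat \<Rightarrow> (nat \<Rightarrow> nat set) \<Rightarrow> nat \<Rightarrow> (nat \<Rightarrow> nat) \<Rightarrow> (nat \<Rightarrow> (nat \<Rightarrow> 'f) \<Rightarrow> 'f) \<Rightarrow> bool" where
  "valid_protocol n I t s g \<longleftrightarrow>
     (\<forall>r<t. s r < n \<and>
        (\<forall>x\<in>space n I. \<forall>y\<in>space n I.
           (\<forall>i\<in>I (s r). x i = y i) \<and> (\<forall>r'<r. g r' x = g r' y) \<longrightarrow> g r x = g r y))"

definition linear_protocol ::
  "nat \<Rightarrow> (nat \<Rightarrow> nat set) \<Rightarrow> nat \<Rightarrow> (nat \<Rightarrow> nat) \<Rightarrow> (nat \<Rightarrow> (nat \<Rightarrow> 'f::field) \<Rightarrow> 'f) \<Rightarrow> bool" where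
  "linear_protocol n I t s g \<longleftrightarrow> valid_protocol n I t s g \<and>
     (\<forall>r<t. \<exists>c :: nat \<Rightarrow> 'f. \<forall>x\<in>space n I. g r x = (\<Sum>i\<in>I (s r). c i * x i))"

text \<open>The protocol (t rounds, broadcasts g) generates the secret key K:
 (i) K can be computed by every client from its own messages and the transcript;
 (ii) K is uniform on F; (iii) K is independent of the transcript (I(K;T)=0).\<close>
definition generates_key ::
  "nat \<Rightarrow> (nat \<Rightarrow> nat set) \<Rightarrow> nat \<Rightarrow> (nat \<Rightarrow> (nat \<Rightarrow> 'f::finite) \<Rightarrow> 'f) \<Rightarrow> ((nat \<Rightarrow> 'f) \<Rightarrow> 'f) \<Rightarrow> bool" where
  "generates_key n I t g K \<longleftrightarrow>
     (\<forall>j<n. \<forall>x\<in>space n I. \<forall>y\<in>space n I.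
        (\<forall>i\<in>I j. x i = y i) \<and> transcript t g x = transcript t g y \<longrightarrow> K x = K y)
   \<and> (\<forall>k. card {x\<in>space n I. K x = k} * card (UNIV :: 'f set) = card (space n I :: (nat \<Rightarrow> 'f) set))
   \<and> (\<forall>k \<tau>. card {x\<in>space n I. K x = k \<and> transcript t g x = \<tau>} * card (space n I :: (nat \<Rightarrow> 'f) set)
            = card {x\<in>space n I. K x = k} * card {x\<in>space n I. transcript t g x = \<tau>})"

definition generates_SK :: "'f::finite itself \<Rightarrow> nat \<Rightarrow> (nat \<Rightarrow> nat set) \<Rightarrow> bool" where
  "generates_SK _ n I \<longleftrightarrow>
     (\<exists>t s (g :: nat \<Rightarrow> (nat \<Rightarrow> 'f) \<Rightarrow> 'f) K. valid_protocol n I t s g \<and> generates_key n I t g K)"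

definition S_L :: "'f::{finite,field} itself \<Rightarrow> nat \<Rightarrow> (nat \<Rightarrow> nat set) \<Rightarrow> nat" where
  "S_L _ n I = (LEAST t. \<exists>s (g :: nat \<Rightarrow> (nat \<Rightarrow> 'f) \<Rightarrow> 'f) K.
                  linear_protocol n I t s g \<and> generates_key n I t g K)"

definition Ibar :: "nat \<Rightarrow> (nat \<Rightarrow> nat set) \<Rightarrow> nat \<Rightarrow> nat set" where
  "Ibar n I j = msgs n I - I j"

definition Mfeasible :: "nat \<Rightarrow> (nat \<Rightarrow> nat set) \<Rightarrow> (nat \<Rightarrow> int) \<Rightarrow> bool" where
  "Mfeasible n I a \<longleftrightarrow>
     (\<forall>S. S \<noteq> {} \<and> S \<subset> {..<n} \<longrightarrow>
        (\<Sum>j\<in>S. a j) \<ge> int (card (\<Inter>j\<in>{..<n} - S. Ibar n I j)))"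

definition Mstar :: "nat \<Rightarrow> (nat \<Rightarrow> nat set) \<Rightarrow> int" where
  "Mstar n I = Inf {(\<Sum>j<n. a j) | a. Mfeasible n I a}"

definition critical :: "nat \<Rightarrow> (nat \<Rightarrow> nat set) \<Rightarrow> nat \<Rightarrow> bool" where
  "critical n J \<tau> \<longleftrightarrow>
     int (card (msgs n J)) - Mstar n J = int \<tau> \<and>
     (\<forall>i\<in>msgs n J. Mstar n (\<lambda>j. J j - {i}) = Mstar n J)"

definition min_critical_subfamily :: "nat \<Rightarrow> (nat \<Rightarrow> nat set) \<Rightarrow> nat \<Rightarrow> nat set \<Rightarrow> bool" where
  "min_critical_subfamily n I \<tau> R \<longleftrightarrow>
     R \<subseteq> msgs n I \<and> critical n (\<lambda>j. I j - R) \<tau> \<and>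
     (\<forall>R'. R' \<subseteq> msgs n I \<and> critical n (\<lambda>j. I j - R') \<tau> \<longrightarrow>
        card (msgs n (\<lambda>j. I j - R)) \<le> card (msgs n (\<lambda>j. I j - R')))"

end

theory Submission
  imports Defs
begin

text \<open>View messages as hyperedges on the clients. A 1-critical family is the same thing as a
  connected hypergraph that becomes disconnected when any hyperedge is removed: a cut crossed by no
  message forces \<open>Mstar\<close> up to the number of messages, and in a connected hypergraph one message can
  be saved. A connected hypergraph with \<open>m\<close> hyperedges yields a key with \<open>m - 1\<close> broadcasts of
  differences along a spanning tree. Conversely, if a linear protocol with \<open>t\<close> broadcasts generates a
  key, consider the message vectors that leave the transcript zero and change the key; the support of
  a smallest one has at most \<open>t + 1\<close> elements and connects the clients.\<close>

section \<open>Hypergraph connectivity and cuts\<close>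

definition connects :: "nat \<Rightarrow> (nat \<Rightarrow> nat set) \<Rightarrow> bool" where
  "connects n J \<longleftrightarrow>
     (\<forall>S. S \<noteq> {} \<and> S \<subset> {..<n} \<longrightarrow> (\<exists>i. \<exists>j\<in>S. \<exists>k\<in>{..<n} - S. i \<in> J j \<and> i \<in> J k))"

text \<open>For a proper subset \<open>S\<close> of the clients this is the intersection of
  complements in the constraint of \<open>Mfeasible\<close>; it stays inside \<open>msgs n J\<close>
  even when no client is left outside \<open>S\<close>.\<close>

definition inner_msgs :: "nat \<Rightarrow> (nat \<Rightarrow> nat set) \<Rightarrow> nat set \<Rightarrow> nat set" where
  "inner_msgs n J S = {i \<in> msgs n J. \<forall>j\<in>{..<n} - S. i \<notin> J j}"

lemma msgs_Diff: "msgs n (\<lambda>j. J j - R) = msgs n J - R"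
  by (auto simp: msgs_def)

lemma connects_cong: "(\<And>j. j < n \<Longrightarrow> J j = K j) \<Longrightarrow> connects n J \<longleftrightarrow> connects n K"
  unfolding connects_def by (intro iff_allI imp_cong refl bex_cong ex_cong1) auto

lemma finite_msgs: "\<forall>j<n. finite (J j) \<Longrightarrow> finite (msgs n J)"
  by (auto simp: msgs_def)

section \<open>Cut bounds for the integer program\<close>

lemma Mfeasible_iff:
  "Mfeasible n J a \<longleftrightarrow>
     (\<forall>S. S \<noteq> {} \<and> S \<subset> {..<n} \<longrightarrow> int (card (inner_msgs n J S)) \<le> (\<Sum>j\<in>S. a j))"
proof -
  have "(\<Inter>j\<in>{..<n} - S. Ibar n J j) = inner_msgs n J S" if "S \<subset> {..<n}" for S
    using that by (auto simp: Ibar_def inner_msgs_def)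
  then show ?thesis
    unfolding Mfeasible_def by auto
qed

text \<open>The constraints for \<open>S\<close> and for its complement are added; together they
  involve every client exactly once.\<close>

lemma Mfeasible_cut:
  assumes "Mfeasible n J a" "S \<noteq> {}" "S \<subset> {..<n}"
  shows "int (card (inner_msgs n J S) + card (inner_msgs n J ({..<n} - S))) \<le> (\<Sum>j<n. a j)"
proof -
  have "(\<Sum>j<n. a j) = (\<Sum>j\<in>{..<n} - S. a j) + (\<Sum>j\<in>S. a j)"
    using assms(3) by (intro sum.subset_diff) auto
  moreover have "{..<n} - S \<noteq> {}" "{..<n} - S \<subset> {..<n}"
    using assms(2,3) by auto
  ultimately show ?thesis
    using assms unfolding Mfeasible_iff by (smt (verit) of_nat_add)
qed

lemma singleton_psubset_lessThan:
  fixes n :: nat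
  assumes "n \<ge> 2" "j < n"
  shows "{j} \<subset> {..<n}"
proof -
  have "card {..<n} \<noteq> card {j}" using assms(1) by simp
  then show ?thesis
    using assms(2) by (metis lessThan_iff psubsetI singletonD subsetI)
qed

text \<open>An infimum of integers is a lower bound only for sets bounded below. With two clients
  the cut at client \<open>0\<close> exists and makes every feasible sum nonnegative.\<close>

lemma Mstar_le:
  assumes "n \<ge> 2" "Mfeasible n J a"
  shows "Mstar n J \<le> (\<Sum>j<n. a j)"
  unfolding Mstar_def
proof (rule cInf_lower)
  have "0 \<le> (\<Sum>j<n. b j)" if "Mfeasible n J b" for b
    using Mfeasible_cut[OF that _ singleton_psubset_lessThan[of n 0]] assms(1) by simp
  then show "bdd_below {(\<Sum>j<n. b j) | b. Mfeasible n J b}"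
    by (intro bdd_belowI[of _ 0]) auto
qed (use assms in auto)

lemma sum_card_preimage:
  assumes "finite S" "finite E"
  shows "(\<Sum>j\<in>S. int (card {i \<in> E. f i = j})) = int (card {i \<in> E. f i \<in> S})"
proof -
  have "{i \<in> E. f i \<in> S} = (\<Union>j\<in>S. {i \<in> E. f i = j})"
    by auto
  then show ?thesis
    using assms by (simp flip: of_nat_sum) (subst card_UN_disjoint; auto)
qed

text \<open>Each message is charged to one of its holders. A message held only inside
  \<open>S\<close> has its owner in \<open>S\<close>, so every constraint holds. This also shows
  that the program is feasible.\<close>

lemma Mfeasible_owner:
  assumes "finite (msgs n J)"
  obtains a where "Mfeasible n J a" "(\<Sum>j<n. a j) = int (card (msgs n J))"
proof -
  obtain f where f: "\<forall>i\<in>msgs n J. f i < n \<and> i \<in> J (f i)"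
    unfolding msgs_def by (metis UN_E lessThan_iff)
  define a where "a j = int (card {i \<in> msgs n J. f i = j})" for j
  have sum_a: "(\<Sum>j\<in>S. a j) = int (card {i \<in> msgs n J. f i \<in> S})" if "S \<subseteq> {..<n}" for S
    unfolding a_def using that assms by (intro sum_card_preimage) (auto intro: finite_subset)
  have "Mfeasible n J a"
    unfolding Mfeasible_iff
  proof (intro allI impI)
    fix S assume S: "S \<noteq> {} \<and> S \<subset> {..<n}"
    have "inner_msgs n J S \<subseteq> {i \<in> msgs n J. f i \<in> S}"
      using f by (auto simp: inner_msgs_def)
    then show "int (card (inner_msgs n J S)) \<le> (\<Sum>j\<in>S. a j)"
      using S assms by (simp add: sum_a card_mono psubset_imp_subset)
  qed
  moreover have "{i \<in> msgs n J. f i \<in> {..<n}} = msgs n J"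
    using f by auto
  ultimately show thesis
    using that[of a] sum_a[of "{..<n}"] by simp
qed

lemma Mstar_le_card:
  assumes "n \<ge> 2" "finite (msgs n J)"
  shows "Mstar n J \<le> int (card (msgs n J))"
  using Mfeasible_owner[OF assms(2)] Mstar_le[OF assms(1)] by metis

lemma Mstar_ge_cut:
  assumes "finite (msgs n J)" "S \<noteq> {}" "S \<subset> {..<n}"
  shows "int (card (inner_msgs n J S) + card (inner_msgs n J ({..<n} - S))) \<le> Mstar n J"
  unfolding Mstar_def
proof (rule cInf_greatest)
  show "{(\<Sum>j<n. a j) | a. Mfeasible n J a} \<noteq> {}"
    using Mfeasible_owner[OF assms(1)] by blast
qed (use Mfeasible_cut[OF _ assms(2,3)] in blast)

text \<open>If no message of \<open>E\<close> crosses the cut, each lies on one side of it, and the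
  two cut constraints count all of \<open>E\<close>. The subset \<open>E\<close> allows a bound for
  \<open>J\<close> from the disconnectedness of a smaller family.\<close>

lemma Mstar_ge_disconnected:
  assumes "finite (msgs n J)" "E \<subseteq> msgs n J" "\<not> connects n (\<lambda>j. J j \<inter> E)"
  shows "int (card E) \<le> Mstar n J"
proof -
  obtain S where S: "S \<noteq> {}" "S \<subset> {..<n}"
    and "\<not> (\<exists>i. \<exists>j\<in>S. \<exists>k\<in>{..<n} - S. i \<in> J j \<inter> E \<and> i \<in> J k \<inter> E)"
    using assms(3) unfolding connects_def by auto
  then have cut: "i \<notin> E" if "j \<in> S" "k \<in> {..<n} - S" "i \<in> J j" "i \<in> J k" for i j k
    using that by blast
  have "E \<subseteq> inner_msgs n J S \<union> inner_msgs n J ({..<n} - S)"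
    using assms(2) cut S(2) by (auto simp: inner_msgs_def)
  moreover have "finite (inner_msgs n J S)" "finite (inner_msgs n J ({..<n} - S))"
    using assms(1) by (auto simp: inner_msgs_def)
  ultimately have "card E \<le> card (inner_msgs n J S) + card (inner_msgs n J ({..<n} - S))"
    by (meson card_Un_le card_mono finite_UnI le_trans)
  then show ?thesis
    using Mstar_ge_cut[OF assms(1) S] by linarith
qed

section \<open>Spanning trees as growth orders\<close>

lemma connects_growth_list:
  assumes "connects n J" "n \<ge> 2" "finite (msgs n J)" "m \<le> card (msgs n J)" "0 < m"
  shows "\<exists>es. length es = m \<and> distinct es \<and> set es \<subseteq> msgs n J \<and>
    (\<forall>k<m. 0 < k \<longrightarrow> (\<exists>v<n. \<exists>l<k. es ! k \<in> J v \<and> es ! l \<in> J v))"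
  using assms(5,4)
proof (induction m rule: nat_induct_non_zero)
  case 1
  then have "msgs n J \<noteq> {}" by auto
  then obtain i where "i \<in> msgs n J" by blast
  then show ?case by (intro exI[of _ "[i]"]) auto
next
  case (Suc m)
  then obtain es where es: "length es = m" "distinct es" "set es \<subseteq> msgs n J"
    and grow: "\<forall>k<m. 0 < k \<longrightarrow> (\<exists>v<n. \<exists>l<k. es ! k \<in> J v \<and> es ! l \<in> J v)"
    by auto
  define U where "U = {v. v < n \<and> (\<exists>i\<in>set es. i \<in> J v)}"
  have "hd es \<in> msgs n J"
    using es Suc.hyps by (metis hd_in_set length_greater_0_conv subsetD)
  then have "U \<noteq> {}"
    using es Suc.hyps unfolding U_def msgs_def
    by (auto dest!: spec intro!: bexI[of _ "hd es"] hd_in_set)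
  have "\<exists>e v. e \<in> msgs n J \<and> e \<notin> set es \<and> v \<in> U \<and> e \<in> J v"
  proof (cases "U = {..<n}")
    case True
    have "card (set es) < card (msgs n J)"
      using es Suc.prems by (simp add: distinct_card)
    then obtain e where "e \<in> msgs n J" "e \<notin> set es"
      by (metis card_mono finite_set leD subsetI)
    then show ?thesis
      using True unfolding msgs_def by auto
  next
    case False
    then have "U \<subset> {..<n}" by (auto simp: U_def)
    then obtain e j k where "j \<in> U" "k \<in> {..<n} - U" "e \<in> J j" "e \<in> J k"
      using assms(1) \<open>U \<noteq> {}\<close> unfolding connects_def by meson
    then show ?thesis
      by (intro exI[of _ e] exI[of _ j]) (auto simp: U_def msgs_def)
  qed
  then obtain e v where e: "e \<in> msgs n J" "e \<notin> set es" "v \<in> U" "e \<in> J v"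
    by blast
  then obtain l where "v < n" "l < m" "es ! l \<in> J v"
    using es(1) by (auto simp: U_def in_set_conv_nth)
  then show ?case
    using es e
  proof (intro exI[of _ "es @ [e]"] conjI allI impI)
    fix k assume k: "k < Suc m" "0 < k"
    show "\<exists>v<n. \<exists>l<k. (es @ [e]) ! k \<in> J v \<and> (es @ [e]) ! l \<in> J v"
    proof (cases "k = m")
      case True
      then show ?thesis
        using \<open>v < n\<close> \<open>l < m\<close> \<open>es ! l \<in> J v\<close> e es(1) by (auto simp: nth_append)
    next
      case False
      then have "k < m" using k by simp
      then obtain v' l' where "v' < n" "l' < k" "es ! k \<in> J v'" "es ! l' \<in> J v'"
        using grow k by blast
      then show ?thesis
        using \<open>k < m\<close> es(1) by (intro exI[of _ v'] conjI exI[of _ l']) (auto simp: nth_append)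
    qed
  qed auto
qed

lemma connects_client_covered:
  assumes "connects n J" "n \<ge> 2" "j < n"
  shows "\<exists>i\<in>msgs n J. i \<in> J j"
proof -
  have "\<exists>i. i \<in> J j"
    using assms(1)[unfolded connects_def, rule_format, of "{j}"]
      singleton_psubset_lessThan[OF assms(2,3)] by auto
  then show ?thesis
    using assms(3) by (auto simp: msgs_def)
qed

lemma connects_card_pos:
  assumes "connects n J" "n \<ge> 2" "finite (msgs n J)"
  shows "0 < card (msgs n J)"
proof -
  have "msgs n J \<noteq> {}"
    using connects_client_covered[OF assms(1,2), of 0] assms(2) by fastforce
  then show ?thesis
    using assms(3) by (simp add: card_gt_0_iff)
qed

text \<open>A spanning tree on the messages: \<open>p k\<close> is the index of the parent of
  message \<open>e k\<close>, and client \<open>v k\<close> holds both. The root has index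
  \<open>0\<close>, where \<open>v\<close> and \<open>p\<close> are unconstrained.\<close>

definition growth_order ::
  "nat \<Rightarrow> (nat \<Rightarrow> nat set) \<Rightarrow> (nat \<Rightarrow> nat) \<Rightarrow> (nat \<Rightarrow> nat) \<Rightarrow> (nat \<Rightarrow> nat) \<Rightarrow> bool" where
  "growth_order n J e v p \<longleftrightarrow>
     bij_betw e {..<card (msgs n J)} (msgs n J) \<and>
     (\<forall>k. 0 < k \<and> k < card (msgs n J) \<longrightarrow>
       v k < n \<and> p k < k \<and> e k \<in> J (v k) \<and> e (p k) \<in> J (v k))"

lemma connects_growth_order:
  assumes "connects n J" "n \<ge> 2" "finite (msgs n J)"
  obtains e v p where "growth_order n J e v p"
proof -
  let ?m = "card (msgs n J)"
  obtain es where es: "length es = ?m" "distinct es" "set es \<subseteq> msgs n J"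
    and grow: "\<forall>k<?m. 0 < k \<longrightarrow> (\<exists>v<n. \<exists>l<k. es ! k \<in> J v \<and> es ! l \<in> J v)"
    using connects_growth_list[OF assms order_refl connects_card_pos[OF assms]] by blast
  have "set es = msgs n J"
    using es assms(3) by (intro card_subset_eq) (auto simp: distinct_card)
  then have "bij_betw (\<lambda>k. es ! k) {..<?m} (msgs n J)"
    using es by (intro bij_betw_nth) auto
  moreover obtain v p where "\<forall>k. 0 < k \<and> k < ?m \<longrightarrow>
      v k < n \<and> p k < k \<and> es ! k \<in> J (v k) \<and> es ! (p k) \<in> J (v k)"
    using grow by metis
  ultimately show thesis
    using that[of "\<lambda>k. es ! k" v p] by (simp add: growth_order_def)
qed

text \<open>Charge every message but the first of a growth order to a client it shares with an earlier
  message. For a client set \<open>S\<close> containing the holders of the first message, the first message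
  reaching outside \<open>S\<close> is charged to a client in \<open>S\<close> and makes up for the uncharged one.\<close>

lemma Mstar_le_connected:
  assumes "connects n J" "n \<ge> 2" "finite (msgs n J)"
  shows "Mstar n J \<le> int (card (msgs n J)) - 1"
proof -
  define m where "m = card (msgs n J)"
  obtain e v p where order: "growth_order n J e v p"
    using connects_growth_order[OF assms] by blast
  then have e: "bij_betw e {..<m} (msgs n J)"
    by (simp add: growth_order_def m_def)
  have grow: "v k < n \<and> p k < k \<and> e k \<in> J (v k) \<and> e (p k) \<in> J (v k)"
    if "0 < k" "k < m" for k
    using order that by (simp add: growth_order_def m_def)
  have m: "0 < m"
    using connects_card_pos[OF assms] by (simp add: m_def)
  define a where "a j = int (card {k \<in> {1..<m}. v k = j})" for j
  have sum_a: "(\<Sum>j\<in>S. a j) = int (card {k \<in> {1..<m}. v k \<in> S})" if "S \<subseteq> {..<n}" for S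
    unfolding a_def using that by (intro sum_card_preimage) (auto intro: finite_subset)
  have "Mfeasible n J a"
    unfolding Mfeasible_iff
  proof (intro allI impI)
    fix S assume S: "S \<noteq> {} \<and> S \<subset> {..<n}"
    define Q where "Q = {k. k < m \<and> e k \<in> inner_msgs n J S}"
    let ?C = "{k \<in> {1..<m}. v k \<in> S}"
    have "inner_msgs n J S = e ` Q"
      using e by (auto simp: Q_def bij_betw_def inner_msgs_def)
    then have "card (inner_msgs n J S) \<le> card Q"
      using card_image_le[of Q e] by (simp add: Q_def)
    also have "card Q \<le> card ?C"
    proof (cases "0 \<in> Q")
      case False
      have "Q \<subseteq> ?C"
      proof
        fix k assume k: "k \<in> Q"
        then have "0 < k" using False by (auto intro: gr0I)
        then show "k \<in> ?C"
          using k grow[of k] by (auto simp: Q_def inner_msgs_def)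
      qed
      then show ?thesis by (intro card_mono) auto
    next
      case True
      \<comment> \<open>A client outside \<open>S\<close> holds some message, so the order does
        leave the inner messages of \<open>S\<close>.\<close>
      obtain j where "j < n" "j \<notin> S" using S by auto
      then obtain i where "i \<in> msgs n J" "i \<in> J j"
        using connects_client_covered[OF assms(1,2)] by blast
      then obtain q where "q < m \<and> e q \<notin> inner_msgs n J S"
        using e \<open>j < n\<close> \<open>j \<notin> S\<close> unfolding inner_msgs_def bij_betw_def by force
      then obtain q where q: "q < m" "e q \<notin> inner_msgs n J S"
        and least: "\<And>k. k < q \<Longrightarrow> k < m \<Longrightarrow> e k \<in> inner_msgs n J S"
        using exists_least_iff[of "\<lambda>q. q < m \<and> e q \<notin> inner_msgs n J S"] by blast
      have "0 < q"
        using True q by (auto simp: Q_def intro: gr0I)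
      then have "v q \<in> S"
        using grow[of q] q least[of "p q"] by (auto simp: inner_msgs_def)
      then have "insert q (Q - {0}) \<subseteq> ?C"
        using grow q \<open>0 < q\<close> by (auto simp: Q_def inner_msgs_def Suc_le_eq)
      then have "card (insert q (Q - {0})) \<le> card ?C"
        by (intro card_mono) auto
      moreover have "card (insert q (Q - {0})) = card Q"
        using True q card_Suc_Diff1[of Q 0] by (simp add: Q_def)
      ultimately show ?thesis by simp
    qed
    finally show "int (card (inner_msgs n J S)) \<le> (\<Sum>j\<in>S. a j)"
      using S by (simp add: sum_a psubset_imp_subset)
  qed
  moreover have "{k \<in> {1..<m}. v k \<in> {..<n}} = {1..<m}"
    using grow by auto
  then have "(\<Sum>j<n. a j) = int m - 1"
    using sum_a[of "{..<n}"] m by simp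
  ultimately show ?thesis
    using Mstar_le[OF assms(2), of J a] by (simp add: m_def)
qed

section \<open>Critical families and minimal connected families\<close>

lemma critical_imp_connects:
  assumes "finite (msgs n J)" "critical n J 1"
  shows "connects n J"
proof (rule ccontr)
  assume "\<not> connects n J"
  moreover have "connects n (\<lambda>j. J j \<inter> msgs n J) \<longleftrightarrow> connects n J"
    by (rule connects_cong) (auto simp: msgs_def)
  ultimately have "int (card (msgs n J)) \<le> Mstar n J"
    using Mstar_ge_disconnected[OF assms(1) order_refl] by blast
  then show False
    using assms(2) by (simp add: critical_def)
qed

text \<open>Deleting any message disconnects the family, so the remaining \<open>?m - 1\<close>
  messages bound both values of \<open>Mstar\<close> from below. The matching upper bounds come from
  connectivity of \<open>J\<close> and from the number of remaining messages.\<close>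

lemma minimal_connects_imp_critical:
  assumes "n \<ge> 2" "finite (msgs n J)" "connects n J"
    and min: "\<And>i. i \<in> msgs n J \<Longrightarrow> \<not> connects n (\<lambda>j. J j - {i})"
  shows "critical n J 1"
proof -
  let ?m = "card (msgs n J)"
  have "int ?m - 1 \<le> Mstar n J \<and> int ?m - 1 \<le> Mstar n (\<lambda>j. J j - {i})
      \<and> Mstar n (\<lambda>j. J j - {i}) \<le> int ?m - 1" if i: "i \<in> msgs n J" for i
  proof -
    let ?J = "\<lambda>j. J j - {i}"
    have m: "card (msgs n ?J) = ?m - 1" "0 < ?m"
      using i assms(2) by (auto simp: msgs_Diff card_gt_0_iff)
    have fin: "finite (msgs n ?J)"
      using assms(2) by (simp add: msgs_Diff)
    have eq: "connects n (\<lambda>j. K j \<inter> msgs n ?J) \<longleftrightarrow> connects n ?J" if "K = J \<or> K = ?J" for K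
      using that by (intro connects_cong) (auto simp: msgs_def)
    have "int (card (msgs n ?J)) \<le> Mstar n J"
      using min[OF i] eq[of J] assms(2)
      by (intro Mstar_ge_disconnected) (auto simp: msgs_Diff)
    moreover have "int (card (msgs n ?J)) \<le> Mstar n ?J"
      using min[OF i] eq[of ?J] fin
      by (intro Mstar_ge_disconnected) auto
    ultimately show ?thesis
      using Mstar_le_card[OF assms(1) fin] m by linarith
  qed
  note bounds = this
  obtain i where "i \<in> msgs n J"
    using connects_client_covered[OF assms(3,1), of 0] assms(1) by auto
  moreover have "Mstar n J \<le> int ?m - 1"
    using Mstar_le_connected[OF assms(3,1,2)] .
  moreover have "0 < ?m"
    using calculation(1) assms(2) by (auto simp: card_gt_0_iff)
  ultimately have "Mstar n J = int ?m - 1"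
    using bounds[of i] by linarith
  then show ?thesis
    unfolding critical_def using bounds by force
qed

text \<open>A connected subfamily with the fewest messages becomes disconnected by any deletion,
  hence is critical. So a minimum critical subfamily is no larger than any connected one.\<close>

lemma min_critical_le_connects:
  assumes "n \<ge> 2" "finite (msgs n I)" "min_critical_subfamily n I 1 R"
    and "R' \<subseteq> msgs n I" "connects n (\<lambda>j. I j - R')"
  shows "card (msgs n (\<lambda>j. I j - R)) \<le> card (msgs n (\<lambda>j. I j - R'))"
proof -
  define P where "P Q \<longleftrightarrow> Q \<subseteq> msgs n I \<and> connects n (\<lambda>j. I j - Q)" for Q
  obtain Q where Q: "P Q"
    and least: "\<And>Q'. P Q' \<Longrightarrow> card (msgs n (\<lambda>j. I j - Q)) \<le> card (msgs n (\<lambda>j. I j - Q'))"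
    using ex_has_least_nat[of P R' "\<lambda>Q. card (msgs n (\<lambda>j. I j - Q))"] assms(4,5)
    by (auto simp: P_def)
  have fin: "finite (msgs n (\<lambda>j. I j - Q))"
    using assms(2) by (simp add: msgs_Diff)
  have "critical n (\<lambda>j. I j - Q) 1"
  proof (rule minimal_connects_imp_critical[OF assms(1) fin])
    show "connects n (\<lambda>j. I j - Q)" using Q by (simp add: P_def)
    fix i assume i: "i \<in> msgs n (\<lambda>j. I j - Q)"
    show "\<not> connects n (\<lambda>j. I j - Q - {i})"
    proof
      assume "connects n (\<lambda>j. I j - Q - {i})"
      moreover have "(\<lambda>j. I j - Q - {i}) = (\<lambda>j. I j - insert i Q)" by blast
      ultimately have "P (insert i Q)"
        using i Q by (simp add: P_def msgs_Diff)
      moreover have "msgs n (\<lambda>j. I j - insert i Q) = msgs n (\<lambda>j. I j - Q) - {i}"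
        by (auto simp: msgs_Diff)
      ultimately show False
        using least[of "insert i Q"] i fin by (metis card_Diff1_less leD)
    qed
  qed
  then have "card (msgs n (\<lambda>j. I j - R)) \<le> card (msgs n (\<lambda>j. I j - Q))"
    using assms(3) Q unfolding min_critical_subfamily_def P_def by blast
  also have "\<dots> \<le> card (msgs n (\<lambda>j. I j - R'))"
    using least assms(4,5) by (simp add: P_def)
  finally show ?thesis .
qed

section \<open>Construction of a linear key\<close>

text \<open>Adding a constant to all messages carries each fibre of \<open>K\<close> injectively
  into any other and preserves \<open>P\<close>, so all fibres within \<open>P\<close> have equal
  size. Trivial \<open>P\<close> gives uniformity; fixing the transcript gives independence.\<close>

lemma card_shift_equivariant:
  fixes K :: "(nat \<Rightarrow> 'f::{finite,field}) \<Rightarrow> 'f"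
  assumes "finite (msgs n I)"
    and K: "\<And>x c. x \<in> space n I \<Longrightarrow> K (\<lambda>i\<in>msgs n I. x i + c) = K x + c"
    and P: "\<And>x c. x \<in> space n I \<Longrightarrow> P x \<Longrightarrow> P (\<lambda>i\<in>msgs n I. x i + c)"
  shows "card {x \<in> space n I. P x} = card (UNIV :: 'f set) * card {x \<in> space n I. K x = k \<and> P x}"
proof -
  define sh where "sh c x = (\<lambda>i\<in>msgs n I. x i + c)" for c :: 'f and x
  let ?A = "\<lambda>k. {x \<in> space n I. K x = k \<and> P x}"
  have sh_sp: "sh c x \<in> space n I" for c x
    by (simp add: sh_def space_def)
  have sh_inv: "sh (- c) (sh c x) = x" if "x \<in> space n I" for c x
    using that by (auto simp: sh_def space_def PiE_iff extensional_def fun_eq_iff)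
  have le: "card (?A k') \<le> card (?A k)" for k k'
  proof (rule card_inj_on_le)
    show "inj_on (sh (k - k')) (?A k')"
      by (rule inj_on_inverseI[of _ "sh (- (k - k'))"]) (blast intro: sh_inv)
    show "sh (k - k') ` ?A k' \<subseteq> ?A k"
      using K P sh_sp unfolding sh_def by auto
    show "finite (?A k)"
      using assms(1) by (simp add: space_def finite_PiE)
  qed
  have "{x \<in> space n I. P x} = (\<Union>k. ?A k)" by auto
  then have "card {x \<in> space n I. P x} = (\<Sum>k\<in>UNIV. card (?A k))"
    using assms(1)
    by (simp only:) (intro card_UN_disjoint; auto simp: space_def finite_PiE)
  also have "\<dots> = (\<Sum>k'\<in>(UNIV :: 'f set). card (?A k))"
    by (intro sum.cong) (auto intro: antisym le)
  finally show ?thesis by simp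
qed

text \<open>Relays broadcast the difference of a message and an earlier one of the growth order, so the
  transcript is invariant under adding a constant to all messages, while the first message, which
  serves as key, is shifted by this constant.\<close>

lemma connects_linear_key:
  assumes "n \<ge> 2" "\<forall>j<n. finite (I j)" "connects n (\<lambda>j. I j - R)"
  shows "\<exists>s (g :: nat \<Rightarrow> (nat \<Rightarrow> 'f::{finite,field}) \<Rightarrow> 'f) K.
    linear_protocol n I (card (msgs n (\<lambda>j. I j - R)) - 1) s g \<and>
    generates_key n I (card (msgs n (\<lambda>j. I j - R)) - 1) g K"
proof -
  define J where "J = (\<lambda>j. I j - R)"
  define m where "m = card (msgs n J)"
  have fin: "finite (msgs n I)" by (rule finite_msgs[OF assms(2)])
  then have finJ: "finite (msgs n J)" by (simp add: J_def msgs_Diff)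
  have conn: "connects n J" using assms(3) by (simp add: J_def)
  obtain e v p where order: "growth_order n J e v p"
    using connects_growth_order[OF conn assms(1) finJ] by blast
  then have e: "bij_betw e {..<m} (msgs n J)"
    by (simp add: growth_order_def m_def)
  have grow: "v k < n \<and> p k < k \<and> e k \<in> J (v k) \<and> e (p k) \<in> J (v k)"
    if "0 < k" "k < m" for k
    using order that by (simp add: growth_order_def m_def)
  have m: "0 < m"
    using connects_card_pos[OF conn assms(1) finJ] by (simp add: m_def)
  have e_in: "e k \<in> msgs n I" if "k < m" for k
    using e that by (auto simp: bij_betw_def J_def msgs_Diff)
  \<comment> \<open>Rounds start at \<open>0\<close>, but the root needs no broadcast, so round
    \<open>r\<close> serves message \<open>Suc r\<close>.\<close>
  define s where "s r = v (Suc r)" for r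
  define g where "g r x = x (e (Suc r)) - x (e (p (Suc r)))" for r and x :: "nat \<Rightarrow> 'f"
  define K where "K x = x (e 0)" for x :: "nat \<Rightarrow> 'f"
  have local: "s r < n" "e (Suc r) \<in> I (s r)" "e (p (Suc r)) \<in> I (s r)" "p (Suc r) < m"
    if "r < m - 1" for r
  proof -
    have "Suc r < m" using that by simp
    then show "s r < n" "e (Suc r) \<in> I (s r)" "e (p (Suc r)) \<in> I (s r)" "p (Suc r) < m"
      using grow[of "Suc r"] by (auto simp: s_def J_def)
  qed
  have "linear_protocol n I (m - 1) s g"
    unfolding linear_protocol_def valid_protocol_def
  proof (intro conjI allI impI ballI)
    fix r assume r: "r < m - 1"
    show "s r < n" by (rule local(1)[OF r])
    show "\<exists>c. \<forall>x\<in>space n I. g r x = (\<Sum>i\<in>I (s r). c i * x i)"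
    proof (intro exI ballI)
      fix x :: "nat \<Rightarrow> 'f"
      have "finite (I (s r))" using assms(2) local(1)[OF r] by blast
      then show "g r x = (\<Sum>i\<in>I (s r). (of_bool (i = e (Suc r)) - of_bool (i = e (p (Suc r)))) * x i)"
        using local(2,3)[OF r]
        by (simp add: g_def left_diff_distrib sum_subtractf of_bool_def if_distrib[of "\<lambda>c. c * _"]
            cong: if_cong)
    qed
  qed (use local in \<open>auto simp: g_def\<close>)
  moreover have "generates_key n I (m - 1) g K"
  proof -
    define T where "T = (transcript (m - 1) g :: (nat \<Rightarrow> 'f) \<Rightarrow> 'f list)"
    have K_shift: "K (\<lambda>i\<in>msgs n I. x i + c) = K x + c" for x c
      using e_in m by (simp add: K_def)
    have T_shift: "T (\<lambda>i\<in>msgs n I. x i + c) = T x" for x c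
      using e_in local(4) by (auto simp: T_def transcript_def g_def)
    have card_T: "card {x \<in> space n I. T x = \<tau>} =
        card (UNIV :: 'f set) * card {x \<in> space n I. K x = k \<and> T x = \<tau>}" for k \<tau>
      by (rule card_shift_equivariant[OF fin K_shift]) (simp add: T_shift)
    have card_space: "card (space n I :: (nat \<Rightarrow> 'f) set) =
        card (UNIV :: 'f set) * card {x \<in> space n I. K x = k}" for k
      using card_shift_equivariant[OF fin, of K "\<lambda>_. True" k] K_shift by simp
    have decode: "K x = K y"
      if "j < n" and agree: "\<forall>i\<in>I j. x i = y i" and T: "T x = T y" for j x y
    proof -
      \<comment> \<open>The broadcast differences carry agreement from a message to its parent,
        hence down to the root, which is the key.\<close>
      have descend: "k < m \<Longrightarrow> x (e k) = y (e k) \<Longrightarrow> x (e 0) = y (e 0)" for k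
      proof (induction k rule: less_induct)
        case (less k)
        show ?case
        proof (cases k)
          case (Suc r)
          then have r: "r < m - 1" using less.prems by simp
          then have "g r x = g r y"
            using T by (simp add: T_def transcript_def)
          then have "x (e (p k)) = y (e (p k))"
            using less.prems(2) Suc by (simp add: g_def)
          then show ?thesis
            using less.IH[of "p k"] grow[of k] less.prems Suc by simp
        qed (use less in simp)
      qed
      obtain i where "i \<in> msgs n J" "i \<in> J j"
        using connects_client_covered[OF conn assms(1) \<open>j < n\<close>] by blast
      then have "i \<in> e ` {..<m}" "i \<in> I j"
        using e by (simp_all add: bij_betw_def J_def)
      then obtain k where "k < m" "e k \<in> I j" by blast
      then show ?thesis
        using descend agree by (simp add: K_def)
    qed
    show ?thesis
      unfolding generates_key_def T_def[symmetric]
    proof (intro conjI allI impI ballI)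
      fix j and x y :: "nat \<Rightarrow> 'f"
      assume "j < n" "(\<forall>i\<in>I j. x i = y i) \<and> T x = T y"
      then show "K x = K y" using decode by blast
    next
      fix k show "card {x \<in> space n I. K x = k} * card (UNIV :: 'f set) = card (space n I :: (nat \<Rightarrow> 'f) set)"
        using card_space[of k] by simp
    next
      fix k \<tau>
      show "card {x \<in> space n I. K x = k \<and> T x = \<tau>} * card (space n I :: (nat \<Rightarrow> 'f) set) =
          card {x \<in> space n I. K x = k} * card {x \<in> space n I. T x = \<tau>}"
        using card_space[of k] card_T[of \<tau> k] by simp
    qed
  qed
  ultimately show ?thesis
    unfolding m_def J_def by blast
qed

section \<open>Lower bound for linear protocols\<close>

text \<open>Pigeonhole: there are more vectors on \<open>A\<close> than value tuples of the
  \<open>t\<close> forms, so two vectors share their values, and their difference is a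
  solution.\<close>

lemma linear_system_nontrivial_solution:
  fixes L :: "nat \<Rightarrow> (nat \<Rightarrow> 'f::{finite,field}) \<Rightarrow> 'f"
  assumes "finite A" "t < card A"
    and L: "\<And>r x y. r < t \<Longrightarrow> L r (\<lambda>i. x i - y i) = L r x - L r y"
  shows "\<exists>y. (\<forall>i. i \<notin> A \<longrightarrow> y i = 0) \<and> (\<forall>r<t. L r y = 0) \<and> (\<exists>i\<in>A. y i \<noteq> 0)"
proof -
  let ?q = "card (UNIV :: 'f set)"
  let ?X = "PiE A (\<lambda>_. UNIV) :: (nat \<Rightarrow> 'f) set"
  let ?Y = "PiE {..<t} (\<lambda>_. UNIV) :: (nat \<Rightarrow> 'f) set"
  \<comment> \<open>Members of \<open>?X\<close> are undefined off \<open>A\<close>; extending by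
    \<open>0\<close> makes the difference vanish there.\<close>
  define z where "z x i = (if i \<in> A then x i else 0)" for x :: "nat \<Rightarrow> 'f" and i
  define ev where "ev x = (\<lambda>r\<in>{..<t}. L r (z x))" for x
  have "card {0, 1 :: 'f} \<le> ?q" by (intro card_mono) auto
  then have "?q ^ t < ?q ^ card A" using assms(2) by (intro power_strict_increasing) auto
  then have "card ?Y < card ?X" using assms(1) by (simp add: card_PiE)
  moreover have "ev ` ?X \<subseteq> ?Y" by (auto simp: ev_def split: if_splits)
  ultimately have "\<not> inj_on ev ?X"
    by (meson card_inj_on_le finite_PiE finite_lessThan finite leD)
  then obtain x y where xy: "x \<in> ?X" "y \<in> ?X" "x \<noteq> y" "ev x = ev y"
    by (auto simp: inj_on_def)
  define d where "d = (\<lambda>i. z x i - z y i)"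
  have "L r d = 0" if "r < t" for r
    using fun_cong[OF xy(4), of r] that L[OF that] by (simp add: ev_def d_def)
  moreover have "\<exists>i\<in>A. d i \<noteq> 0"
  proof -
    obtain i where "i \<in> A" "x i \<noteq> y i" using PiE_ext[OF xy(1,2)] xy(3) by blast
    then show ?thesis by (auto simp: d_def z_def)
  qed
  moreover have "\<forall>i. i \<notin> A \<longrightarrow> d i = 0" by (simp add: d_def z_def)
  ultimately show ?thesis by blast
qed

text \<open>Let \<open>V\<close> be the message vectors with zero transcript and \<open>D\<close> the vectors of \<open>V\<close> that can be added
  without changing the key. A vector of \<open>V\<close> invisible to some client is in \<open>D\<close>, but \<open>V\<close> is not
  contained in \<open>D\<close>. If the support of a vector \<open>x\<close> in \<open>V - D\<close> does not connect the clients, \<open>x\<close> splits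
  into two vectors of \<open>V\<close>, each invisible to some client. If the support has minimal size but more
  than \<open>t + 1\<close> elements, there is a nonzero \<open>y\<close> in \<open>V\<close> with strictly smaller support, and \<open>x\<close> is the
  sum of a multiple of \<open>y\<close> and a vector with another strictly smaller support.\<close>

lemma linear_key_connects:
  fixes g :: "nat \<Rightarrow> (nat \<Rightarrow> 'f::{finite,field}) \<Rightarrow> 'f"
  assumes "\<forall>j<n. finite (I j)" "linear_protocol n I t s g" "generates_key n I t g K"
  obtains R where "R \<subseteq> msgs n I" "connects n (\<lambda>j. I j - R)" "card (msgs n (\<lambda>j. I j - R)) \<le> t + 1"
proof -
  let ?M = "msgs n I"
  have fin: "finite ?M" by (rule finite_msgs[OF assms(1)])
  have s: "s r < n" if "r < t" for r
    using assms(2) that by (auto simp: linear_protocol_def valid_protocol_def)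
  obtain c where c: "\<And>r x. r < t \<Longrightarrow> x \<in> space n I \<Longrightarrow> g r x = (\<Sum>i\<in>I (s r). c r i * x i)"
    using assms(2) unfolding linear_protocol_def by metis
  define L where "L r x = (\<Sum>i\<in>I (s r). c r i * x i)" for r and x :: "nat \<Rightarrow> 'f"
  have L_add: "L r (\<lambda>i. x i + y i) = L r x + L r y"
    and L_diff: "L r (\<lambda>i. x i - y i) = L r x - L r y"
    and L_mult: "L r (\<lambda>i. b * x i) = b * L r x" for r x y b
    by (simp_all add: L_def algebra_simps sum.distrib sum_subtractf sum_distrib_left)
  have restr: "restrict x ?M \<in> space n I" for x :: "nat \<Rightarrow> 'f"
    by (simp add: space_def)
  have g_L: "g r (restrict x ?M) = L r x" if "r < t" for r x
    using c[OF that restr] s[OF that] by (auto simp: L_def msgs_def intro!: sum.cong)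
  \<comment> \<open>Vectors in \<open>V\<close> vanish off \<open>?M\<close>, so that they can be
    added pointwise; \<open>restrict\<close> turns them into points of
    \<open>space n I\<close>.\<close>
  define \<kappa> where "\<kappa> x = K (restrict x ?M)" for x
  define V where "V = {x. (\<forall>i. i \<notin> ?M \<longrightarrow> x i = 0) \<and> (\<forall>r<t. L r x = 0)}"
  define D where "D = {d \<in> V. \<forall>x\<in>V. \<kappa> (\<lambda>i. x i + d i) = \<kappa> x}"
  define supp where "supp x = {i \<in> ?M. x i \<noteq> 0}" for x :: "nat \<Rightarrow> 'f"
  have zero_V: "(\<lambda>_. 0) \<in> V" by (simp add: V_def L_def)
  have V_add: "(\<lambda>i. x i + y i) \<in> V" if "x \<in> V" "y \<in> V" for x y
    using that by (auto simp: V_def L_add)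
  have V_mult: "(\<lambda>i. b * x i) \<in> V" if "x \<in> V" for b x
    using that by (auto simp: V_def L_mult)
  have D_add: "(\<lambda>i. d i + d' i) \<in> D" if "d \<in> D" "d' \<in> D" for d d'
    using that V_add by (auto simp: D_def add.assoc[symmetric])
  have T0: "transcript t g (restrict x ?M) = replicate t 0" if "x \<in> V" for x
    using that g_L by (auto simp: V_def transcript_def intro!: nth_equalityI)
  \<comment> \<open>Client \<open>j\<close> sees the same messages and the same zero transcript with
    and without \<open>d\<close>, so it decodes the same key.\<close>
  have invisible: "d \<in> D" if "d \<in> V" "j < n" "\<And>i. i \<in> I j \<Longrightarrow> d i = 0" for d j
  proof -
    have "\<kappa> (\<lambda>i. x i + d i) = \<kappa> x" if "x \<in> V" for x
    proof -
      have "\<forall>i\<in>I j. restrict (\<lambda>i. x i + d i) ?M i = restrict x ?M i"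
        using \<open>\<And>i. i \<in> I j \<Longrightarrow> d i = 0\<close> by (auto simp: restrict_def)
      moreover have "transcript t g (restrict (\<lambda>i. x i + d i) ?M) = transcript t g (restrict x ?M)"
        using T0 V_add \<open>x \<in> V\<close> \<open>d \<in> V\<close> by simp
      ultimately show ?thesis
        using assms(3) restr \<open>j < n\<close> unfolding generates_key_def \<kappa>_def by blast
    qed
    then show ?thesis using \<open>d \<in> V\<close> by (simp add: D_def)
  qed
  \<comment> \<open>The zero transcript occurs, so by uniformity and independence it occurs together
    with every key value.\<close>
  have key_on_V: "\<exists>x\<in>V. \<kappa> x = k" for k
  proof -
    let ?\<tau> = "replicate t (0 :: 'f)"
    have fin_sp: "finite (space n I :: (nat \<Rightarrow> 'f) set)"
      using fin by (simp add: space_def finite_PiE)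
    have T_pos: "0 < card {x \<in> space n I. transcript t g x = ?\<tau>}"
      using T0[OF zero_V] restr[of "\<lambda>_. 0"] fin_sp by (auto simp: card_gt_0_iff)
    have unif: "card {x \<in> space n I. K x = k} * card (UNIV :: 'f set) = card (space n I :: (nat \<Rightarrow> 'f) set)"
      and indep: "card {x \<in> space n I. K x = k \<and> transcript t g x = ?\<tau>} * card (space n I :: (nat \<Rightarrow> 'f) set)
        = card {x \<in> space n I. K x = k} * card {x \<in> space n I. transcript t g x = ?\<tau>}"
      using assms(3) unfolding generates_key_def by blast+
    have "0 < card (space n I :: (nat \<Rightarrow> 'f) set)"
      using restr fin_sp by (auto simp: card_gt_0_iff)
    then have "0 < card {x \<in> space n I. K x = k}"
      unfolding unif[symmetric] by simp
    then have "0 < card {x \<in> space n I. K x = k \<and> transcript t g x = ?\<tau>} *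
        card (space n I :: (nat \<Rightarrow> 'f) set)"
      unfolding indep using T_pos by simp
    then have "0 < card {x \<in> space n I. K x = k \<and> transcript t g x = ?\<tau>}"
      by simp
    then obtain x where x: "x \<in> space n I" "K x = k" "transcript t g x = ?\<tau>"
      by (auto simp: card_gt_0_iff)
    define y where "y i = (if i \<in> ?M then x i else 0)" for i
    have xy: "restrict y ?M = x"
      using x(1) by (auto simp: y_def space_def PiE_iff extensional_def fun_eq_iff)
    have "L r y = 0" if "r < t" for r
    proof -
      have "g r x = transcript t g x ! r" using that by (simp add: transcript_def)
      then show ?thesis using g_L[OF that, of y] xy x(3) that by simp
    qed
    then have "y \<in> V" by (simp add: V_def y_def)
    then show ?thesis using xy x(2) by (auto simp: \<kappa>_def)
  qed
  have "\<exists>x. x \<in> V - D"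
  proof (rule ccontr)
    assume "\<nexists>x. x \<in> V - D"
    \<comment> \<open>Otherwise adding \<open>x\<close> to the zero vector would show the key to be
      constant on \<open>V\<close>.\<close>
    have "\<kappa> x = \<kappa> (\<lambda>_. 0)" if "x \<in> V" for x
    proof -
      have "x \<in> D" using \<open>\<nexists>x. x \<in> V - D\<close> that by blast
      then have "\<forall>y\<in>V. \<kappa> (\<lambda>i. y i + x i) = \<kappa> y" by (simp add: D_def)
      from bspec[OF this zero_V] show ?thesis by simp
    qed
    then show False using key_on_V[of 0] key_on_V[of 1] by (metis zero_neq_one)
  qed
  then obtain x0 where "x0 \<in> V - D" by blast
  from ex_has_least_nat[of "\<lambda>x. x \<in> V - D", OF this, of "\<lambda>x. card (supp x)"]
  obtain x where x: "x \<in> V" "x \<notin> D"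
    and least: "\<And>y. y \<in> V \<Longrightarrow> y \<notin> D \<Longrightarrow> card (supp x) \<le> card (supp y)"
    by blast
  have smaller: "y \<in> D" if "y \<in> V" "supp y \<subset> supp x" for y
    using least[OF that(1)] psubset_card_mono[OF _ that(2)] fin by (force simp: supp_def)
  have x_supp: "x i = 0" if "i \<notin> supp x" for i
    using x(1) that by (auto simp: V_def supp_def)
  have "card (supp x) \<le> t + 1"
  proof (rule ccontr)
    assume "\<not> card (supp x) \<le> t + 1"
    then have gt: "t + 1 < card (supp x)" by simp
    \<comment> \<open>Giving up coordinate \<open>i0\<close> makes the support of \<open>y\<close>
      strictly smaller and still leaves more than \<open>t\<close> unknowns.\<close>
    then obtain i0 where i0: "i0 \<in> supp x" by fastforce
    have "finite (supp x)" using fin by (simp add: supp_def)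
    then have "finite (supp x - {i0})" "t < card (supp x - {i0})"
      using gt i0 by simp_all
    from linear_system_nontrivial_solution[of _ _ L, OF this L_diff]
    obtain y where y: "\<forall>i. i \<notin> supp x - {i0} \<longrightarrow> y i = 0" "\<forall>r<t. L r y = 0"
      and "\<exists>i\<in>supp x - {i0}. y i \<noteq> 0"
      by blast
    then obtain i where i: "i \<in> supp x" "y i \<noteq> 0" by auto
    have yV: "y \<in> V" using y by (auto simp: V_def supp_def)
    \<comment> \<open>This factor makes \<open>x - b * y\<close> vanish at \<open>i\<close>.\<close>
    define b where "b = x i / y i"
    let ?u = "\<lambda>k. x k + (- b) * y k" and ?w = "\<lambda>k. b * y k"
    have "supp ?w \<subseteq> supp x - {i0}" using y(1) by (auto simp: supp_def)
    then have w_D: "?w \<in> D" using V_mult[OF yV] i0 by (intro smaller) auto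
    have "?u k = 0" if "k \<notin> supp x - {i}" for k
      using y(1) x_supp[of k] i that by (cases "k = i") (simp_all add: b_def)
    then have "supp ?u \<subseteq> supp x - {i}"
      unfolding supp_def by blast
    then have u_D: "?u \<in> D"
      using i(1) by (intro smaller[OF V_add[OF x(1) V_mult[OF yV]]]) blast
    show False using D_add[OF u_D w_D] x(2) by simp
  qed
  moreover have "connects n (\<lambda>j. I j - (?M - supp x))"
  proof (rule ccontr)
    assume "\<not> ?thesis"
    then obtain S where S: "S \<noteq> {}" "S \<subset> {..<n}"
      and "\<not> (\<exists>i. \<exists>j\<in>S. \<exists>k\<in>{..<n} - S. i \<in> I j - (?M - supp x) \<and> i \<in> I k - (?M - supp x))"
      unfolding connects_def by auto
    then have cut: "i \<notin> supp x" if "j \<in> S" "k \<in> {..<n} - S" "i \<in> I j" "i \<in> I k" for i j k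
      using that by blast
    \<comment> \<open>\<open>u\<close> is the part of \<open>x\<close> held by clients in
      \<open>S\<close>. No message in the support of \<open>x\<close> crosses the cut, so clients
      outside \<open>S\<close> see only zeros of \<open>u\<close>.\<close>
    define u where "u i = (if \<exists>j\<in>S. i \<in> I j then x i else 0)" for i
    define w where "w i = (if \<exists>j\<in>S. i \<in> I j then 0 else x i)" for i
    have u_out: "u i = 0" if "k \<in> {..<n} - S" "i \<in> I k" for i k
      using cut that x_supp by (auto simp: u_def)
    have x_eq: "x = (\<lambda>i. u i + w i)" by (auto simp: u_def w_def)
    have Lx: "L r x = L r u + L r w" for r unfolding x_eq by (rule L_add)
    \<comment> \<open>The transmitter sees only zeros of one of the two parts; the other value
      vanishes because the sum does.\<close>
    have "L r u = 0 \<and> L r w = 0" if "r < t" for r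
    proof (cases "s r \<in> S")
      case True
      then have "L r w = 0" by (auto simp: L_def w_def intro!: sum.neutral)
      then show ?thesis using Lx[of r] x(1) that by (simp add: V_def)
    next
      case False
      then have "L r u = 0" using u_out s[OF that] by (auto simp: L_def intro!: sum.neutral)
      then show ?thesis using Lx[of r] x(1) that by (simp add: V_def)
    qed
    then have "u \<in> V" "w \<in> V"
      using x(1) by (auto simp: V_def u_def w_def)
    moreover obtain k where "k \<in> {..<n} - S" using S(2) by auto
    then have "u \<in> D" using u_out \<open>u \<in> V\<close> by (intro invisible[of u k]) auto
    moreover obtain j where "j \<in> S" using S(1) by auto
    then have "w \<in> D" using S(2) \<open>w \<in> V\<close> by (intro invisible[of w j]) (auto simp: w_def)
    ultimately show False using x(2) D_add x_eq by metis
  qed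
  moreover have "msgs n (\<lambda>j. I j - (?M - supp x)) = supp x"
    by (auto simp: msgs_Diff supp_def)
  ultimately show thesis
    using that[of "?M - supp x"] by simp
qed

section \<open>The minimum number of linear transmissions\<close>

text \<open>The first conjunct records that the minimum is attained, since \<open>LEAST\<close>
  alone would also denote a number if no linear protocol existed.\<close>

theorem theorem5:
  fixes n :: nat and I :: "nat \<Rightarrow> nat set" and R :: "nat set"
  assumes "n \<ge> 2"
    and "\<forall>j<n. finite (I j)"
    and "card (UNIV :: ('f::{finite,field}) set) > n"
    and "generates_SK TYPE('f) n I"
    and "min_critical_subfamily n I 1 R"
  shows "(\<exists>s (g :: nat \<Rightarrow> (nat \<Rightarrow> 'f) \<Rightarrow> 'f) K.
            linear_protocol n I (S_L TYPE('f) n I) s g \<and> generates_key n I (S_L TYPE('f) n I) g K)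
       \<and> int (S_L TYPE('f) n I) = Mstar n (\<lambda>j. I j - R)
       \<and> Mstar n (\<lambda>j. I j - R) = int (card (msgs n (\<lambda>j. I j - R))) - 1"
proof -
  let ?J = "\<lambda>j. I j - R"
  let ?m = "card (msgs n ?J)"
  have fin: "finite (msgs n I)" by (rule finite_msgs[OF assms(2)])
  then have finJ: "finite (msgs n ?J)" by (simp add: msgs_Diff)
  have crit: "critical n ?J 1"
    using assms(5) by (simp add: min_critical_subfamily_def)
  have conn: "connects n ?J" by (rule critical_imp_connects[OF finJ crit])
  have "0 < ?m"
    by (rule connects_card_pos[OF conn assms(1) finJ])
  have ex: "\<exists>s (g :: nat \<Rightarrow> (nat \<Rightarrow> 'f) \<Rightarrow> 'f) K.
      linear_protocol n I (?m - 1) s g \<and> generates_key n I (?m - 1) g K"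
    by (rule connects_linear_key[OF assms(1,2) conn])
  have "S_L TYPE('f) n I = ?m - 1"
    unfolding S_L_def
  proof (rule Least_equality)
    show "\<exists>s (g :: nat \<Rightarrow> (nat \<Rightarrow> 'f) \<Rightarrow> 'f) K.
        linear_protocol n I (?m - 1) s g \<and> generates_key n I (?m - 1) g K" by (rule ex)
    fix t
    assume "\<exists>s (g :: nat \<Rightarrow> (nat \<Rightarrow> 'f) \<Rightarrow> 'f) K. linear_protocol n I t s g \<and> generates_key n I t g K"
    then obtain s and g :: "nat \<Rightarrow> (nat \<Rightarrow> 'f) \<Rightarrow> 'f" and K
      where "linear_protocol n I t s g" "generates_key n I t g K" by blast
    then obtain R' where R': "R' \<subseteq> msgs n I" "connects n (\<lambda>j. I j - R')"
      "card (msgs n (\<lambda>j. I j - R')) \<le> t + 1"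
      by (rule linear_key_connects[OF assms(2)])
    show "?m - 1 \<le> t"
      using min_critical_le_connects[OF assms(1) fin assms(5) R'(1,2)] R'(3) by linarith
  qed
  then show ?thesis
    using ex crit \<open>0 < ?m\<close> by (auto simp: critical_def)
qed

end
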